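(* Among the five theta constants $\theta[\tfrac15;\tfrac k5]$, $(k=1,3,5,7,9)$, there exist at most three which are algebraically independent over $\mathbb{C}$.
   Context: Let $\mathbb{H}^2=\{\tau\in\mathbb{C}:\Im\tau>0\}$. For $(\epsilon,\epsilon')\in\mathbb{R}^2$, $$\theta[\epsilon;\epsilon'](\zeta,\tau)=\sum_{n\in\mathbb{Z}}\exp\Big(2\pi i\Big[\tfrac12\big(n+\tfrac{\epsilon}{2}\big)^2\tau+\big(n+\tfrac{\epsilon}{2}\big)\big(\zeta+\tfrac{\epsilon'}{2}\big)\Big]\Big),$$ and the theta constant $\theta[\epsilon;\epsilon']=\theta[\epsilon;\epsilon'](0,\tau)$ is regarded as a holomorphic function of $\tau\in\mathbb{H}^2$; algebraic independence is as elements of the field of meromorphic functions on $\mathbb{H}^2$. *)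

theory Defs
  imports "HOL-Analysis.Analysis"
begin

definition theta :: "real \<Rightarrow> real \<Rightarrow> complex \<Rightarrow> complex \<Rightarrow> complex" where
  "theta eps eps' z tau =
     (\<Sum>\<^sub>\<infinity> n::int. exp (2 * of_real pi * \<i> *
        ((1/2) * (of_int n + of_real eps / 2)^2 * tau
         + (of_int n + of_real eps / 2) * (z + of_real eps' / 2))))"

definition theta_const :: "real \<Rightarrow> real \<Rightarrow> complex \<Rightarrow> complex" where
  "theta_const eps eps' tau = theta eps eps' 0 tau"

definition upper_half_plane :: "complex set" where
  "upper_half_plane = {tau. Im tau > 0}"

text \<open>A family f indexed by the finite set I of functions on the (connected) domain S is
  algebraically dependent over the complex numbers if some nonzero polynomial in the variables
  indexed by I (coefficient function c on exponent vectors supported in I, finitely many nonzero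
  coefficients) vanishes identically on S when evaluated at the f i.\<close>
definition alg_dependent_on :: "'a set \<Rightarrow> ('i \<Rightarrow> 'a \<Rightarrow> complex) \<Rightarrow> 'i set \<Rightarrow> bool" where
  "alg_dependent_on S f I \<longleftrightarrow>
     (\<exists>c :: ('i \<Rightarrow> nat) \<Rightarrow> complex.
        finite {e. c e \<noteq> 0} \<and> {e. c e \<noteq> 0} \<noteq> {} \<and>
        (\<forall>e. c e \<noteq> 0 \<longrightarrow> (\<forall>i. i \<notin> I \<longrightarrow> e i = 0)) \<and>
        (\<forall>tau\<in>S. (\<Sum>e\<in>{e. c e \<noteq> 0}. c e * (\<Prod>i\<in>I. f i tau ^ e i)) = 0))"

definition alg_independent_on :: "'a set \<Rightarrow> ('i \<Rightarrow> 'a \<Rightarrow> complex) \<Rightarrow> 'i set \<Rightarrow> bool" where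
  "alg_independent_on S f I \<longleftrightarrow> \<not> alg_dependent_on S f I"

end

theory Submission
  imports Defs "HOL-Complex_Analysis.Complex_Analysis"
begin

text \<open>Write \<open>\<theta>\<^sub>e(x)\<close> for \<open>\<theta>[e;x](0,\<tau>)\<close>. Summing over \<open>m + n\<close> and \<open>m - n\<close> shows that
  \<open>\<theta>\<^sub>e(x + y) \<theta>\<^sub>e(x - y)\<close> is a linear form depending on \<open>x\<close>, evaluated at a vector of \<open>\<complex>\<^sup>2\<close>
  depending on \<open>y\<close> only. The three vectors for \<open>y = 0, 2/5, 4/5\<close> are linearly dependent, and their
  \<open>2 \<times> 2\<close> minors are \<open>-a\<^sup>2\<close>, \<open>-b\<^sup>2\<close>, \<open>-a b\<close> for two odd theta constants \<open>a\<close>, \<open>b\<close>. This gives the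
  quadrics of the elliptic normal quintic,
  \<open>a\<^sup>2 \<theta>(x + 4/5) \<theta>(x - 4/5) + a b \<theta>(x)\<^sup>2 = b\<^sup>2 \<theta>(x + 2/5) \<theta>(x - 2/5)\<close>,
  one for each of the five constants. For any four of the constants, the remaining one and the ratio
  \<open>b / a\<close> can be eliminated from three of the quadrics, which leaves a nonzero polynomial relation.
  It holds where \<open>a \<noteq> 0\<close>, in particular for large \<open>Im \<tau>\<close>, hence everywhere by the identity theorem.\<close>

section \<open>Convergence of the theta series\<close>

definition theta_term :: "real \<Rightarrow> real \<Rightarrow> complex \<Rightarrow> int \<Rightarrow> complex" where
  "theta_term e x t n = exp (2 * of_real pi * \<i> *
     ((1/2) * (of_int n + of_real e / 2)^2 * t + (of_int n + of_real e / 2) * (of_real x / 2)))"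

lemma theta_const_eq: "theta_const e x t = (\<Sum>\<^sub>\<infinity>n. theta_term e x t n)"
  by (simp add: theta_const_def theta_def theta_term_def)

lemma norm_theta_term: "norm (theta_term e x t n) = exp (- (pi * Im t * (of_int n + e / 2)^2))"
proof -
  define u :: real where "u = of_int n + e / 2"
  have "(of_int n + of_real e / 2 :: complex) = of_real u"
    by (simp add: u_def)
  then have "theta_term e x t n = exp (2 * of_real pi * \<i> * ((1/2) * of_real u^2 * t + of_real u * (of_real x / 2)))"
    by (simp only: theta_term_def)
  then show ?thesis
    by (simp add: u_def[symmetric] power2_eq_square mult_ac)
qed

lemma has_sum_geometric_int:
  fixes r :: real
  assumes "0 \<le> r" "r < 1"
  shows "((\<lambda>n::int. r ^ nat \<bar>n\<bar>) has_sum (1 + 2 * (r / (1 - r)))) UNIV"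
proof -
  let ?f = "\<lambda>n::int. r ^ nat \<bar>n\<bar>"
  have nat: "((\<lambda>n. r ^ n) has_sum (r / (1 - r))) {1..}"
    using has_sum_geometric_from_1[of r] assms by simp
  have pos: "(?f has_sum (r / (1 - r))) (int ` {1..})"
    by (subst has_sum_reindex) (use nat in \<open>auto simp: o_def\<close>)
  have neg: "(?f has_sum (r / (1 - r))) ((\<lambda>n. - int n) ` {1..})"
    by (subst has_sum_reindex) (use nat in \<open>auto simp: o_def inj_on_def\<close>)
  have zero: "(?f has_sum 1) {0}"
    using has_sum_finite[of "{0}" ?f] by simp
  have "(?f has_sum (1 + r / (1 - r) + r / (1 - r))) (({0} \<union> int ` {1..}) \<union> (\<lambda>n. - int n) ` {1..})"
    by (intro has_sum_Un_disjoint zero pos neg) auto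
  also have "({0} \<union> int ` {1..}) \<union> (\<lambda>n. - int n) ` {1..} = UNIV"
  proof -
    have "n \<in> ({0} \<union> int ` {1..}) \<union> (\<lambda>n. - int n) ` {1..}" for n
      by (cases n rule: int_cases3) auto
    then show ?thesis by blast
  qed
  finally show ?thesis by (simp add: add_ac)
qed

text \<open>Expanding (|n + c| - 1)^2 >= 0 bounds the square below by 2 |n + c| - 1, hence by 2 |n|
  - 2 |c| - 1, which gives a two-sided geometric majorant.\<close>

lemma gauss_le_geometric:
  fixes a c :: real
  assumes "a \<ge> 0"
  shows "exp (- (a * (of_int n + c)^2)) \<le> exp (a * (2 * \<bar>c\<bar> + 1)) * exp (- (2 * a)) ^ nat \<bar>n\<bar>"
proof -
  have "(\<bar>of_int n + c\<bar> - 1)^2 \<ge> 0" by simp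
  then have "(of_int n + c)^2 \<ge> 2 * \<bar>of_int n + c\<bar> - 1"
    by (simp add: power2_eq_square algebra_simps)
  moreover have "\<bar>of_int n\<bar> \<le> \<bar>of_int n + c\<bar> + \<bar>c\<bar>"
    by linarith
  ultimately have "2 * \<bar>of_int n\<bar> - 2 * \<bar>c\<bar> - 1 \<le> (of_int n + c)^2"
    by argo
  then have "a * (2 * \<bar>of_int n\<bar> - 2 * \<bar>c\<bar> - 1) \<le> a * (of_int n + c)^2"
    using assms by (intro mult_left_mono)
  then have "- (a * (of_int n + c)^2) \<le> a * (2 * \<bar>c\<bar> + 1) + real (nat \<bar>n\<bar>) * (- (2 * a))"
    by (simp add: algebra_simps)
  then show ?thesis
    by (simp only: exp_of_nat_mult[symmetric] exp_add[symmetric] exp_le_cancel_iff)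
qed

lemma summable_on_gauss:
  fixes a c :: real
  assumes "a > 0"
  shows "(\<lambda>n. exp (- (a * (of_int n + c)^2))) summable_on (UNIV :: int set)"
proof (rule summable_on_comparison_test)
  show "(\<lambda>n::int. exp (a * (2 * \<bar>c\<bar> + 1)) * exp (- (2 * a)) ^ nat \<bar>n\<bar>) summable_on UNIV"
    using has_sum_geometric_int[of "exp (- (2 * a))"] assms
    by (intro summable_on_cmult_right) (auto simp: summable_on_def)
qed (use gauss_le_geometric assms in auto)

lemma theta_term_abs_summable: "Im t > 0 \<Longrightarrow> (\<lambda>n. norm (theta_term e x t n)) summable_on UNIV"
  using summable_on_gauss[of "pi * Im t" "e / 2"] by (simp add: norm_theta_term)

lemma theta_term_summable: "Im t > 0 \<Longrightarrow> theta_term e x t summable_on A"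
  using theta_term_abs_summable abs_summable_summable summable_on_subset_banach by blast

section \<open>Products of theta constants\<close>

lemma abs_summable_times:
  fixes f g :: "_ \<Rightarrow> 'a :: {real_normed_div_algebra, banach}"
  assumes "(\<lambda>m. norm (f m)) summable_on A" "(\<lambda>n. norm (g n)) summable_on B"
  shows "(\<lambda>p. norm (case p of (m, n) \<Rightarrow> f m * g n)) summable_on A \<times> B"
    and "(\<Sum>\<^sub>\<infinity>(m, n)\<in>A \<times> B. f m * g n) = infsum f A * infsum g B"
proof -
  show *: "(\<lambda>p. norm (case p of (m, n) \<Rightarrow> f m * g n)) summable_on A \<times> B"
    unfolding Infinite_Sum.abs_summable_on_Sigma_iff using assms
    by (auto simp: norm_mult infsum_cmult_right' infsum_nonneg intro!: summable_on_cmult_right summable_on_cmult_left)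
  have "(\<Sum>\<^sub>\<infinity>(m, n)\<in>A \<times> B. f m * g n) = (\<Sum>\<^sub>\<infinity>m\<in>A. \<Sum>\<^sub>\<infinity>n\<in>B. f m * g n)"
    using infsum_Sigma_banach[OF abs_summable_summable[OF *]] by simp
  then show "(\<Sum>\<^sub>\<infinity>(m, n)\<in>A \<times> B. f m * g n) = infsum f A * infsum g B"
    by (simp add: infsum_cmult_right' infsum_cmult_left')
qed

text \<open>Parallelogram law: with u = j + e/2, (u + k)^2 + (u - k)^2 = 2 u^2 + 2 k^2 separates the
  quadratic exponent, and the mixed products cancel in the linear one.\<close>

lemma theta_term_mult_even:
  "theta_term e (x + y) t (j + k) * theta_term e (x - y) t (j - k)
     = theta_term e (2 * x) (2 * t) j * theta_term 0 (2 * y) (2 * t) k"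
  unfolding theta_term_def exp_add[symmetric]
  by (rule arg_cong[of _ _ exp]) (simp add: field_simps power2_eq_square)

text \<open>The same separation for u = j + (e + 1)/2 and v = k + 1/2: the two shifted indices are u
  + v and u - v.\<close>

lemma theta_term_mult_odd:
  "theta_term e (x + y) t (j + k + 1) * theta_term e (x - y) t (j - k)
     = theta_term (e + 1) (2 * x) (2 * t) j * theta_term 1 (2 * y) (2 * t) k"
  unfolding theta_term_def exp_add[symmetric]
  by (rule arg_cong[of _ _ exp]) (simp add: field_simps power2_eq_square)

text \<open>Absolute convergence lets the double series be split by the parity of m + n: even pairs
  are (j + k, j - k), odd ones (j + k + 1, j - k), each exactly once.\<close>

lemma theta_const_mult:
  assumes "Im t > 0"
  shows "theta_const e (x + y) t * theta_const e (x - y) t =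
    theta_const e (2 * x) (2 * t) * theta_const 0 (2 * y) (2 * t)
    + theta_const (e + 1) (2 * x) (2 * t) * theta_const 1 (2 * y) (2 * t)"
proof -
  let ?F = "\<lambda>(m, n). theta_term e (x + y) t m * theta_term e (x - y) t n"
  define g0 g1 :: "int \<times> int \<Rightarrow> int \<times> int"
    where "g0 = (\<lambda>(j, k). (j + k, j - k))" and "g1 = (\<lambda>(j, k). (j + k + 1, j - k))"
  have inj: "inj g0" "inj g1"
    by (auto simp: inj_on_def g0_def g1_def)
  have sum_eq: "infsum ?F (range g0 \<union> range g1) = infsum ?F (range g0) + infsum ?F (range g1)"
  proof (rule infsum_Un_disjoint)
    have "?F summable_on UNIV \<times> UNIV"
      using abs_summable_times(1) theta_term_abs_summable assms abs_summable_summable by blast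
    then show "?F summable_on range g0" "?F summable_on range g1"
      by (rule summable_on_subset_banach; simp)+
    show "range g0 \<inter> range g1 = {}"
      unfolding g0_def g1_def by auto presburger
  qed
  have "(m, n) \<in> range g0 \<union> range g1" for m n
  proof (cases "even (m + n)")
    case True
    then have "(m, n) = g0 ((m + n) div 2, (m - n) div 2)"
      unfolding g0_def by (auto, presburger+)
    then show ?thesis by blast
  next
    case False
    then have "(m, n) = g1 ((m + n) div 2, (m - n) div 2)"
      unfolding g1_def by (auto, presburger+)
    then show ?thesis by blast
  qed
  then have "range g0 \<union> range g1 = UNIV \<times> UNIV"
    by auto
  with sum_eq have "infsum ?F (UNIV \<times> UNIV) = infsum (?F \<circ> g0) (UNIV \<times> UNIV) + infsum (?F \<circ> g1) (UNIV \<times> UNIV)"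
    using inj by (simp add: infsum_reindex)
  also have "?F \<circ> g0 = (\<lambda>(j, k). theta_term e (2 * x) (2 * t) j * theta_term 0 (2 * y) (2 * t) k)"
    using theta_term_mult_even by (auto simp: g0_def fun_eq_iff)
  also have "?F \<circ> g1 = (\<lambda>(j, k). theta_term (e + 1) (2 * x) (2 * t) j * theta_term 1 (2 * y) (2 * t) k)"
    using theta_term_mult_odd by (auto simp: g1_def fun_eq_iff)
  finally show ?thesis
    using assms by (simp add: abs_summable_times(2) theta_term_abs_summable theta_const_eq del: UNIV_Times_UNIV)
qed

section \<open>Quasi-periodicity, parity and the odd theta function\<close>

lemma theta_const_add_2: "theta_const e (x + 2) t = exp (of_real (pi * e) * \<i>) * theta_const e x t"
proof -
  have "theta_term e (x + 2) t n = exp (of_real (pi * e) * \<i>) * theta_term e x t n" for n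
  proof -
    have "theta_term e (x + 2) t n = theta_term e x t n * exp (of_real (pi * e) * \<i>) * exp (2 * of_int n * of_real pi * \<i>)"
      unfolding theta_term_def exp_add[symmetric]
      by (rule arg_cong[of _ _ exp]) (simp add: field_simps)
    then show ?thesis
      using exp_integer_2pi[of "of_int n"] by (simp add: mult_ac)
  qed
  then show ?thesis
    by (simp add: theta_const_eq infsum_cmult_right')
qed

lemma theta_const_add_2_left: "theta_const (e + 2) x t = theta_const e x t"
proof -
  have "infsum (\<lambda>n. theta_term e x t (n + 1)) UNIV = infsum (theta_term e x t) UNIV"
    by (rule infsum_reindex_bij_betw) (rule bij_betw_byWitness[where f' = "\<lambda>n. n - 1"]; simp)
  moreover have "theta_term e x t (n + 1) = theta_term (e + 2) x t n" for n
    by (simp add: theta_term_def field_simps)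
  ultimately show ?thesis
    by (simp add: theta_const_eq)
qed

lemma theta_const_minus: "theta_const (- e) (- x) t = theta_const e x t"
proof -
  have "infsum (\<lambda>n. theta_term e x t (- n)) UNIV = infsum (theta_term e x t) UNIV"
    by (rule infsum_reindex_bij_betw) (rule bij_betw_byWitness[where f' = "\<lambda>n. - n"]; simp)
  moreover have "theta_term e x t (- n) = theta_term (- e) (- x) t n" for n
    unfolding theta_term_def
    by (rule arg_cong[of _ _ exp]) (simp add: field_simps power2_eq_square)
  ultimately show ?thesis
    by (simp add: theta_const_eq)
qed

text \<open>Up to sign, Jacobi's odd theta function \<open>\<theta>\<^sub>1\<close> at \<open>x / 2\<close>.\<close>
definition theta_odd :: "real \<Rightarrow> complex \<Rightarrow> complex" where
  "theta_odd x t = theta_const 1 (1 + x) t"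

lemma theta_odd_add_2: "theta_odd (x + 2) t = - theta_odd x t"
  using theta_const_add_2[of 1 "1 + x" t] by (simp add: theta_odd_def add_ac exp_pi_i')

lemma theta_odd_minus: "theta_odd (- x) t = - theta_odd x t"
proof -
  have "theta_odd (- x) t = theta_const (- 1) (- (x - 1)) t"
    using theta_const_add_2_left[of "- 1" "1 - x" t] by (simp add: theta_odd_def)
  also have "\<dots> = theta_const 1 (x - 1) t"
    by (rule theta_const_minus)
  also have "\<dots> = - theta_odd x t"
    using theta_const_add_2[of 1 "x - 1" t] by (simp add: theta_odd_def add_ac exp_pi_i')
  finally show ?thesis .
qed

text \<open>The case e = 1 of \<open>theta_const_mult\<close> at 1 + x; shifting 2 * x by 2 changes
  the sign in characteristic 1 only. The right-hand side is thus a 2 x 2 minor.\<close>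

lemma theta_odd_mult:
  assumes "Im t > 0"
  shows "theta_odd (x + y) t * theta_odd (x - y) t =
    theta_const 0 (2 * x) (2 * t) * theta_const 1 (2 * y) (2 * t)
    - theta_const 1 (2 * x) (2 * t) * theta_const 0 (2 * y) (2 * t)"
proof -
  have "theta_odd (x + y) t * theta_odd (x - y) t =
     theta_const 1 (2 * x + 2) (2 * t) * theta_const 0 (2 * y) (2 * t)
    + theta_const 0 (2 * x + 2) (2 * t) * theta_const 1 (2 * y) (2 * t)"
    using theta_const_add_2_left[of 0] theta_const_mult[OF assms, of 1 "1 + x" y] by (simp add: theta_odd_def algebra_simps)
  then show ?thesis
    by (simp only: theta_const_add_2) (simp add: exp_pi_i')
qed

lemma theta_const_quintic_relation:
  assumes t: "Im t > 0"
  shows "theta_odd (2/5) t ^ 2 * (theta_const e (x + 4/5) t * theta_const e (x - 4/5) t)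
     + theta_odd (2/5) t * theta_odd (4/5) t * theta_const e x t ^ 2
     = theta_odd (4/5) t ^ 2 * (theta_const e (x + 2/5) t * theta_const e (x - 2/5) t)"
proof -
  define X0 X1 where "X0 = theta_const e (2 * x) (2 * t)" and "X1 = theta_const (e + 1) (2 * x) (2 * t)"
  define Y0 Y1 where "Y0 = (\<lambda>y. theta_const 0 (2 * y) (2 * t))" and "Y1 = (\<lambda>y. theta_const 1 (2 * y) (2 * t))"
  have T: "theta_const e (x + y) t * theta_const e (x - y) t = X0 * Y0 y + X1 * Y1 y" for y
    using theta_const_mult[OF t] by (simp add: X0_def X1_def Y0_def Y1_def)
  have S: "theta_odd (x + y) t * theta_odd (x - y) t = Y0 x * Y1 y - Y1 x * Y0 y" for x y
    using theta_odd_mult[OF t] by (simp add: Y0_def Y1_def)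
  \<comment> \<open>6/5 = 2 - 4/5, and the sign of the shift cancels that of oddness.\<close>
  have "theta_odd (6/5) t = theta_odd (4/5) t"
    using theta_odd_add_2[of "- 4/5" t] theta_odd_minus[of "4/5" t] by simp
  then have D12: "- (theta_odd (4/5) t * theta_odd (2/5) t) = Y0 (2/5) * Y1 (4/5) - Y1 (2/5) * Y0 (4/5)"
    using S[of "2/5" "4/5"] theta_odd_minus[of "2/5" t] by simp
  have D01: "- (theta_odd (2/5) t ^ 2) = Y0 0 * Y1 (2/5) - Y1 0 * Y0 (2/5)"
    using S[of 0 "2/5"] theta_odd_minus[of "2/5" t] by (simp add: power2_eq_square)
  have D02: "- (theta_odd (4/5) t ^ 2) = Y0 0 * Y1 (4/5) - Y1 0 * Y0 (4/5)"
    using S[of 0 "4/5"] theta_odd_minus[of "4/5" t] by (simp add: power2_eq_square)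
  have "theta_const e x t ^ 2 = X0 * Y0 0 + X1 * Y1 0"
    using T[of 0] by (simp add: power2_eq_square)
  \<comment> \<open>For Y = (Y0, Y1), Cramer's identity D12 Y(0) - D02 Y(2/5) + D01 Y(4/5) = 0 is
    paired with (X0, X1).\<close>
  with D01 D02 D12 T[of "2/5"] T[of "4/5"] show ?thesis
    by algebra
qed

section \<open>Nonvanishing and holomorphy\<close>

text \<open>The terms n = 0 and n = -1 dominate: their sum has modulus at least \<open>?c\<close>,
  while all others together contribute at most 5/12 of \<open>?c\<close>.\<close>

lemma theta_odd_two_fifths_nonzero:
  assumes "Im t \<ge> 1"
  shows "theta_odd (2/5) t \<noteq> 0"
proof
  assume zero: "theta_odd (2/5) t = 0"
  let ?f = "theta_term 1 (7/5) t"
  let ?c = "exp (- (pi * Im t / 4))"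
  have t: "Im t > 0" using assms by linarith
  have "?f 0 + ?f (- 1) = exp (of_real pi * \<i> * t / 4) * of_real (2 * cos (7 / 10 * pi))"
  proof -
    have "?f 0 = exp (of_real pi * \<i> * t / 4) * exp (\<i> * of_real (7 / 10 * pi))"
      unfolding theta_term_def exp_add[symmetric]
      by (rule arg_cong[of _ _ exp]) (simp add: field_simps power2_eq_square)
    moreover have "?f (- 1) = exp (of_real pi * \<i> * t / 4) * exp (- (\<i> * of_real (7 / 10 * pi)))"
      unfolding theta_term_def exp_add[symmetric]
      by (rule arg_cong[of _ _ exp]) (simp add: field_simps power2_eq_square)
    ultimately have "?f 0 + ?f (- 1) = exp (of_real pi * \<i> * t / 4) * (2 * cos (of_real (7 / 10 * pi)))"
      unfolding cos_exp_eq by (simp add: algebra_simps)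
    then show ?thesis
      unfolding of_real_mult[of 2 "cos (7 / 10 * pi)"] cos_of_real by simp
  qed
  then have "norm (?f 0 + ?f (- 1)) = ?c * (2 * \<bar>cos (7 / 10 * pi)\<bar>)"
    by (simp add: norm_mult)
  \<comment> \<open>The angle 2 pi / 3, with cosine -1/2, is close enough to show that the two
    leading terms do not cancel.\<close>
  moreover have "cos (7 / 10 * pi) \<le> cos (2 / 3 * pi)"
    by (rule cos_monotone_0_pi_le) auto
  then have "2 * \<bar>cos (7 / 10 * pi)\<bar> \<ge> 1"
    using cos_120' by (simp add: abs_if mult.commute)
  ultimately have lower: "norm (?f 0 + ?f (- 1)) \<ge> ?c"
    by simp
  have rest: "(?f has_sum (0 - (?f 0 + ?f (- 1)))) (UNIV - {0, - 1})"
  proof (rule has_sum_Diff)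
    have "infsum ?f UNIV = 0"
      using zero by (simp add: theta_odd_def theta_const_eq)
    then show "(?f has_sum 0) UNIV"
      using has_sum_infsum[OF theta_term_summable[OF t]] by metis
    show "(?f has_sum (?f 0 + ?f (- 1))) {0, - 1}"
      using has_sum_finite[of "{0, - 1}" ?f] by simp
  qed simp
  \<comment> \<open>5/3 is the full two-sided series of ratio 1/4, and 5/4 its terms at 0 and
    -1.\<close>
  have geo: "((\<lambda>n::int. ?c * (1/4) ^ nat \<bar>n\<bar>) has_sum (?c * (5/3 - 5/4))) (UNIV - {0, - 1})"
  proof (intro has_sum_cmult_right has_sum_Diff)
    show "((\<lambda>n::int. (1/4::real) ^ nat \<bar>n\<bar>) has_sum (5/3)) UNIV"
      using has_sum_geometric_int[of "1/4"] by simp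
    show "((\<lambda>n::int. (1/4::real) ^ nat \<bar>n\<bar>) has_sum (5/4)) {0, - 1}"
      using has_sum_finite[of "{0, - 1}" "\<lambda>n::int. (1/4::real) ^ nat \<bar>n\<bar>"] by simp
  qed simp
  have "norm (0 - (?f 0 + ?f (- 1))) \<le> ?c * (5/3 - 5/4)"
  proof (rule norm_infsum_le[OF rest geo])
    fix n :: int assume n: "n \<in> UNIV - {0, - 1}"
    \<comment> \<open>Since (n + 1/2)^2 = n^2 + n + 1/4, this yields decay at rate |n| + 1/4. It
      fails at n = -1, one of the two terms split off.\<close>
    have "\<bar>n\<bar> \<le> n * n + n"
    proof (cases "n \<ge> 0")
      case False
      then have "0 \<le> (- n) * (- n - 2)"
        using n by (intro mult_nonneg_nonneg) auto
      then show ?thesis using False by (simp add: algebra_simps)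
    qed simp
    then have "real_of_int \<bar>n\<bar> \<le> real_of_int (n * n + n)"
      by linarith
    then have "pi * Im t * (real (nat \<bar>n\<bar>) + 1 / 4) \<le> pi * Im t * (of_int n + 1 / 2)^2"
      using t by (intro mult_left_mono) (auto simp: power2_eq_square field_simps)
    then have "norm (?f n) \<le> ?c * exp (real (nat \<bar>n\<bar>) * (- (pi * Im t)))"
      by (simp add: norm_theta_term algebra_simps flip: exp_add)
    also have "\<dots> = ?c * exp (- (pi * Im t)) ^ nat \<bar>n\<bar>"
      by (simp only: exp_of_nat_mult)
    also have "\<dots> \<le> ?c * (1/4) ^ nat \<bar>n\<bar>"
    proof (intro mult_left_mono power_mono)
      have "3 * 1 \<le> pi * Im t"
        using assms pi_gt3 by (intro mult_mono) auto
      then have "4 \<le> exp (pi * Im t)"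
        using exp_ge_add_one_self[of "pi * Im t"] by linarith
      then show "exp (- (pi * Im t)) \<le> 1 / 4"
        by (simp add: exp_minus field_simps)
    qed auto
    finally show "norm (?f n) \<le> ?c * (1/4) ^ nat \<bar>n\<bar>" .
  qed
  also have "?c * (5/3 - 5/4) < ?c"
    by simp
  finally have "norm (?f 0 + ?f (- 1)) < ?c"
    by (simp only: diff_0 norm_minus_cancel)
  with lower show False by simp
qed

text \<open>On the disc of radius Im z / 2 about z, Im t stays at least Im z / 2, so one Gaussian
  majorizes every series there and the M-test gives a uniform limit of holomorphic
  functions.\<close>

lemma theta_const_holomorphic: "theta_const e x holomorphic_on upper_half_plane"
proof -
  have "theta_const e x holomorphic_on ball z (Im z / 2)" if "Im z > 0" for z
  proof -
    let ?r = "Im z / 2"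
    have bound: "norm (theta_term e x t n) \<le> exp (- (pi * ?r * (of_int n + e / 2)^2))"
      if "t \<in> cball z ?r" for t n
    proof -
      have "Im t \<ge> ?r"
        using abs_Im_le_cmod[of "z - t"] that by (simp add: dist_norm abs_le_iff)
      then have "pi * ?r * (of_int n + e / 2)^2 \<le> pi * Im t * (of_int n + e / 2)^2"
        by (intro mult_right_mono mult_left_mono) auto
      then show ?thesis
        by (simp add: norm_theta_term)
    qed
    have "uniform_limit (cball z ?r) (\<lambda>N t. \<Sum>n\<in>N. theta_term e x t n)
            (\<lambda>t. \<Sum>\<^sub>\<infinity>n. theta_term e x t n) (finite_subsets_at_top UNIV)"
      by (rule Weierstrass_m_test_general[OF bound summable_on_gauss]) (use that in auto)
    then have ul: "uniform_limit (cball z ?r) (\<lambda>N t. \<Sum>n\<in>N. theta_term e x t n)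
            (theta_const e x) (finite_subsets_at_top UNIV)"
      by (simp add: theta_const_eq[abs_def])
    have "continuous_on (cball z ?r) (\<lambda>t. \<Sum>n\<in>N. theta_term e x t n) \<and>
        (\<lambda>t. \<Sum>n\<in>N. theta_term e x t n) holomorphic_on ball z ?r" for N
      unfolding theta_term_def by (intro conjI continuous_intros holomorphic_intros)
    then show ?thesis
      using holomorphic_uniform_limit[OF _ ul] by auto
  qed
  moreover have "z \<in> ball z (Im z / 2)" if "Im z > 0" for z
    using that by simp
  ultimately show ?thesis
    unfolding upper_half_plane_def
    by (metis (mono_tags, lifting) at_within_open field_differentiable_at_within holomorphic_on_def mem_Collect_eq open_ball)
qed


section \<open>Periodic normalisation and elimination\<close>

lemma open_upper_half_plane: "open upper_half_plane"
  unfolding upper_half_plane_def by (rule open_halfspace_Im_gt)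

lemma connected_upper_half_plane: "connected upper_half_plane"
  unfolding upper_half_plane_def by (intro convex_connected convex_halfspace_Im_gt)

text \<open>The exponential factor turns the quasi-period 2 of \<open>x \<mapsto> \<theta>[1/5;x]\<close> into a period.\<close>
definition theta_unif :: "real \<Rightarrow> complex \<Rightarrow> complex" where
  "theta_unif x t = exp (- (of_real (pi * x / 10) * \<i>)) * theta_const (1/5) x t"

lemma theta_unif_add_2: "theta_unif (x + 2) t = theta_unif x t"
proof -
  have "exp (- (of_real (pi * (x + 2) / 10) * \<i>)) * exp (of_real (pi * (1/5)) * \<i>) =
      exp (- (of_real (pi * x / 10) * \<i>))"
    unfolding exp_add[symmetric] by (rule arg_cong[of _ _ exp]) (simp add: field_simps)
  then show ?thesis
    unfolding theta_unif_def theta_const_add_2 by (simp only: mult.assoc[symmetric])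
qed

lemma theta_unif_holomorphic: "theta_unif x holomorphic_on upper_half_plane"
  unfolding theta_unif_def by (intro holomorphic_intros theta_const_holomorphic)

text \<open>Each product has arguments symmetric about x, so the normalisation multiplies every term
  by the same factor \<open>?E x ^ 2\<close>.\<close>

lemma theta_unif_quintic_relation:
  assumes "Im t > 0"
  shows "theta_odd (2/5) t ^ 2 * (theta_unif (x + 4/5) t * theta_unif (x - 4/5) t)
     + theta_odd (2/5) t * theta_odd (4/5) t * theta_unif x t ^ 2
     = theta_odd (4/5) t ^ 2 * (theta_unif (x + 2/5) t * theta_unif (x - 2/5) t)"
proof -
  let ?E = "\<lambda>x. exp (- (of_real (pi * x / 10) * \<i>))"
  have E: "?E (x + y) * ?E (x - y) = ?E x ^ 2" for y
    unfolding exp_double[symmetric] exp_add[symmetric]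
    by (rule arg_cong[of _ _ exp]) (simp add: field_simps)
  have "theta_unif (x + y) t * theta_unif (x - y) t =
      ?E x ^ 2 * (theta_const (1/5) (x + y) t * theta_const (1/5) (x - y) t)" for y
    using E[of y] by (simp add: theta_unif_def algebra_simps)
  moreover have "theta_unif x t ^ 2 = ?E x ^ 2 * theta_const (1/5) x t ^ 2"
    by (simp add: theta_unif_def power_mult_distrib)
  ultimately show ?thesis
    using arg_cong[OF theta_const_quintic_relation[OF assms, of "1/5" x], of "(*) (?E x ^ 2)"]
    by (simp only: distrib_left mult_ac)
qed

text \<open>With \<open>u = b / a\<close>, eliminating \<open>h\<^sub>0\<close> from the quadrics \<open>r1\<close>, \<open>r4\<close> of the next lemma gives
  \<open>D = - u N\<close> for \<open>N = h\<^sub>1\<^sup>2 h\<^sub>3 - h\<^sub>2 h\<^sub>4\<^sup>2\<close> and \<open>D = h\<^sub>3\<^sup>2 h\<^sub>4 - h\<^sub>1 h\<^sub>2\<^sup>2\<close>; the polynomial results from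
  eliminating \<open>h\<^sub>0\<close> from \<open>r0\<close>, \<open>r1\<close> and clearing the denominators of \<open>u = - D / N\<close>.\<close>
definition elim_poly :: "complex \<Rightarrow> complex \<Rightarrow> complex \<Rightarrow> complex \<Rightarrow> complex" where
  "elim_poly h1 h2 h3 h4 =
     (h1^2 * h3 - h2 * h4^2)^3
       * ((h1^2 * h3 - h2 * h4^2) * h3 * h4 - (h3^2 * h4 - h1 * h2^2) * h1^2)^2
     - (h3^2 * h4 - h1 * h2^2)^3 * h2^2
       * ((h1^2 * h3 - h2 * h4^2)^2 * h2 * h3 - (h3^2 * h4 - h1 * h2^2)^2 * h1 * h4)"

lemma elim_poly_eq_0:
  fixes a b :: complex
  assumes a: "a \<noteq> 0"
    and r0: "a^2 * (h2 * h3) + a * b * h0^2 = b^2 * (h1 * h4)"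
    and r1: "a^2 * (h3 * h4) + a * b * h1^2 = b^2 * (h2 * h0)"
    and r4: "a^2 * (h1 * h2) + a * b * h4^2 = b^2 * (h0 * h3)"
  shows "elim_poly h1 h2 h3 h4 = 0"
proof -
  define u where "u = b / a"
  have b: "b = a * u" using a by (simp add: u_def)
  have cancel: "p = q" if "a^2 * p = a^2 * q" for p q
    using a that by simp
  define N D where "N = h1^2 * h3 - h2 * h4^2" and "D = h3^2 * h4 - h1 * h2^2"
  have s0: "u * h0^2 = u^2 * (h1 * h4) - h2 * h3"
    by (rule cancel) (use r0 in \<open>simp add: b power2_eq_square algebra_simps\<close>)
  have s1: "h3 * h4 + u * h1^2 = u^2 * (h2 * h0)"
    by (rule cancel) (use r1 in \<open>simp add: b power2_eq_square algebra_simps\<close>)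
  have s4: "h1 * h2 + u * h4^2 = u^2 * (h0 * h3)"
    by (rule cancel) (use r4 in \<open>simp add: b power2_eq_square algebra_simps\<close>)
  \<comment> \<open>h3 times \<open>s1\<close> minus h2 times \<open>s4\<close> removes h0.\<close>
  have D: "D = - u * N"
    using s1 s4 unfolding N_def D_def by algebra
  \<comment> \<open>Squaring \<open>s1\<close> produces h0^2, which \<open>s0\<close> expresses
    through the other variables.\<close>
  have "(h3 * h4 + u * h1^2)^2 = u^3 * h2^2 * (u * h0^2)"
    unfolding s1 by (simp add: power2_eq_square power3_eq_cube)
  then have key: "(h3 * h4 + u * h1^2)^2 = u^3 * h2^2 * (u^2 * (h1 * h4) - h2 * h3)"
    unfolding s0 .
  define v w where "v = u^2 * (h1 * h4) - h2 * h3" and "w = h3 * h4 + u * h1^2"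
  have e1: "N * h3 * h4 - D * h1^2 = N * w"
    by (simp add: D w_def algebra_simps)
  have e2: "N^2 * h2 * h3 - D^2 * h1 * h4 = - (N^2 * v)"
    by (simp add: D v_def algebra_simps power_mult_distrib)
  have e3: "D^3 = - (u^3 * N^3)"
    by (simp add: D power_mult_distrib power3_eq_cube)
  have e4: "w^2 = u^3 * h2^2 * v"
    using key by (simp add: v_def w_def)
  \<comment> \<open>This is N^5 times \<open>key\<close>; nothing is divided by N, so N = 0 is
    covered.\<close>
  have "N^3 * (N * h3 * h4 - D * h1^2)^2 - D^3 * h2^2 * (N^2 * h2 * h3 - D^2 * h1 * h4) = 0"
    unfolding e1 e2 e3 power_mult_distrib e4 by (simp add: mult_ac)
  then show ?thesis
    by (simp add: elim_poly_def N_def D_def)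
qed

text \<open>By the period 2, indices of the five values at steps of 2/5 count modulo 5. The quadrics
  centred at x, x + 2/5 and x - 2/5 serve as \<open>r0\<close>, \<open>r1\<close> and
  \<open>r4\<close>.\<close>

lemma elim_poly_theta_unif:
  assumes "t \<in> upper_half_plane"
  shows "elim_poly (theta_unif (x + 2/5) t) (theta_unif (x + 4/5) t)
           (theta_unif (x + 6/5) t) (theta_unif (x + 8/5) t) = 0"
    (is "?P t = 0")
proof (rule analytic_continuation_open[where f = "?P" and z = t and g = "\<lambda>_. 0" and s = "{t. Im t > 1}"])
  show "open {t. Im t > 1}" by (rule open_halfspace_Im_gt)
  have "2 * \<i> \<in> {t. Im t > 1}" by simp
  then show "{t. Im t > 1} \<noteq> {}" by blast
  show "{t. Im t > 1} \<subseteq> upper_half_plane"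
    by (auto simp: upper_half_plane_def)
  show "?P holomorphic_on upper_half_plane"
    unfolding elim_poly_def by (intro holomorphic_intros theta_unif_holomorphic)
  fix t assume "t \<in> {t. Im t > 1}"
  then have t: "Im t \<ge> 1" "Im t > 0" by auto
  have p: "theta_unif (x - 4/5) t = theta_unif (x + 6/5) t"
    "theta_unif (x - 2/5) t = theta_unif (x + 8/5) t"
    "theta_unif (x - 6/5) t = theta_unif (x + 4/5) t"
    using theta_unif_add_2[of "x - 4/5" t] theta_unif_add_2[of "x - 2/5" t]
      theta_unif_add_2[of "x - 6/5" t] by (simp_all add: add_ac)
  show "?P t = 0"
  proof (rule elim_poly_eq_0[OF theta_odd_two_fifths_nonzero[OF t(1)]])
    note rel = theta_unif_quintic_relation[OF t(2)]
    show "theta_odd (2/5) t ^ 2 * (theta_unif (x + 4/5) t * theta_unif (x + 6/5) t)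
       + theta_odd (2/5) t * theta_odd (4/5) t * theta_unif x t ^ 2
       = theta_odd (4/5) t ^ 2 * (theta_unif (x + 2/5) t * theta_unif (x + 8/5) t)"
      using rel[of x] by (simp add: p)
    show "theta_odd (2/5) t ^ 2 * (theta_unif (x + 6/5) t * theta_unif (x + 8/5) t)
       + theta_odd (2/5) t * theta_odd (4/5) t * theta_unif (x + 2/5) t ^ 2
       = theta_odd (4/5) t ^ 2 * (theta_unif (x + 4/5) t * theta_unif x t)"
      using rel[of "x + 2/5"] by (simp add: p add.commute[of "_ / 5" x])
    show "theta_odd (2/5) t ^ 2 * (theta_unif (x + 2/5) t * theta_unif (x + 4/5) t)
       + theta_odd (2/5) t * theta_odd (4/5) t * theta_unif (x + 8/5) t ^ 2
       = theta_odd (4/5) t ^ 2 * (theta_unif x t * theta_unif (x + 6/5) t)"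
      using rel[of "x - 2/5"] by (simp add: p add.commute[of "_ / 5" x])
  qed
qed (use assms open_upper_half_plane connected_upper_half_plane in auto)

section \<open>Polynomial functions and algebraic dependence\<close>

text \<open>The coefficient encoding of \<open>alg_dependent_on\<close>, seen as a function: closure
  under ring operations then replaces writing out the coefficients of
  \<open>elim_poly\<close>.\<close>

definition mpoly_fun :: "'i set \<Rightarrow> (('i \<Rightarrow> complex) \<Rightarrow> complex) \<Rightarrow> bool" where
  "mpoly_fun I F \<longleftrightarrow> (\<exists>c :: ('i \<Rightarrow> nat) \<Rightarrow> complex.
     finite {e. c e \<noteq> 0} \<and> (\<forall>e. c e \<noteq> 0 \<longrightarrow> (\<forall>i. i \<notin> I \<longrightarrow> e i = 0)) \<and>
     (\<forall>x. F x = (\<Sum>e\<in>{e. c e \<noteq> 0}. c e * (\<Prod>i\<in>I. x i ^ e i))))"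

text \<open>\<open>c\<close> may vanish on parts of \<open>S\<close>, which absorbs cancellation of
  coefficients in sums and products.\<close>

lemma mpoly_funI:
  assumes "finite S" "\<And>e i. e \<in> S \<Longrightarrow> i \<notin> I \<Longrightarrow> e i = 0"
    and F: "\<And>x. F x = (\<Sum>e\<in>S. c e * (\<Prod>i\<in>I. x i ^ e i))"
  shows "mpoly_fun I F"
  unfolding mpoly_fun_def
proof (intro exI[of _ "\<lambda>e. if e \<in> S then c e else 0"] conjI allI impI)
  fix x
  show "F x = (\<Sum>e\<in>{e. (if e \<in> S then c e else 0) \<noteq> 0}. (if e \<in> S then c e else 0) * (\<Prod>i\<in>I. x i ^ e i))"
    unfolding F by (rule sum.mono_neutral_cong_right) (use assms(1) in \<open>auto split: if_splits\<close>)
qed (use assms in \<open>auto split: if_splits\<close>)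

lemma mpoly_fun_const: "mpoly_fun I (\<lambda>_. a)"
  by (rule mpoly_funI[of "{\<lambda>_. 0}" _ _ "\<lambda>_. a"]) auto

lemma mpoly_fun_var:
  assumes "finite I" "i \<in> I"
  shows "mpoly_fun I (\<lambda>x. x i)"
proof (rule mpoly_funI[of "{\<lambda>j. if j = i then 1 else 0}" _ _ "\<lambda>_. 1"])
  fix x :: "'a \<Rightarrow> complex"
  have "(\<Prod>j\<in>I. x j ^ (if j = i then 1 else 0)) = (\<Prod>j\<in>I. if j = i then x j else 1)"
    by (intro prod.cong) auto
  then show "x i = (\<Sum>e\<in>{\<lambda>j. if j = i then 1 else 0}. 1 * (\<Prod>j\<in>I. x j ^ e j))"
    using assms by simp
qed (use assms in auto)

lemma mpoly_fun_add:
  assumes "mpoly_fun I F" "mpoly_fun I G"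
  shows "mpoly_fun I (\<lambda>x. F x + G x)"
proof -
  obtain c where c: "finite {e. c e \<noteq> 0}" "\<And>e i. c e \<noteq> 0 \<Longrightarrow> i \<notin> I \<Longrightarrow> e i = 0"
    "\<And>x. F x = (\<Sum>e\<in>{e. c e \<noteq> 0}. c e * (\<Prod>i\<in>I. x i ^ e i))"
    using assms(1) unfolding mpoly_fun_def by blast
  obtain d where d: "finite {e. d e \<noteq> 0}" "\<And>e i. d e \<noteq> 0 \<Longrightarrow> i \<notin> I \<Longrightarrow> e i = 0"
    "\<And>x. G x = (\<Sum>e\<in>{e. d e \<noteq> 0}. d e * (\<Prod>i\<in>I. x i ^ e i))"
    using assms(2) unfolding mpoly_fun_def by blast
  let ?S = "{e. c e \<noteq> 0} \<union> {e. d e \<noteq> 0}"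
  have "F x = (\<Sum>e\<in>?S. c e * (\<Prod>i\<in>I. x i ^ e i))" for x
    unfolding c(3) using c(1) d(1) by (intro sum.mono_neutral_left) auto
  moreover have "G x = (\<Sum>e\<in>?S. d e * (\<Prod>i\<in>I. x i ^ e i))" for x
    unfolding d(3) using c(1) d(1) by (intro sum.mono_neutral_left) auto
  ultimately show ?thesis
    using c(1,2) d(1,2)
    by (intro mpoly_funI[of ?S _ _ "\<lambda>e. c e + d e"]) (auto simp: sum.distrib distrib_right)
qed

lemma mpoly_fun_mult:
  assumes "mpoly_fun I F" "mpoly_fun I G"
  shows "mpoly_fun I (\<lambda>x. F x * G x)"
proof -
  obtain c where c: "finite {e. c e \<noteq> 0}" "\<And>e i. c e \<noteq> 0 \<Longrightarrow> i \<notin> I \<Longrightarrow> e i = 0"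
    "\<And>x. F x = (\<Sum>e\<in>{e. c e \<noteq> 0}. c e * (\<Prod>i\<in>I. x i ^ e i))"
    using assms(1) unfolding mpoly_fun_def by blast
  obtain d where d: "finite {e. d e \<noteq> 0}" "\<And>e i. d e \<noteq> 0 \<Longrightarrow> i \<notin> I \<Longrightarrow> e i = 0"
    "\<And>x. G x = (\<Sum>e\<in>{e. d e \<noteq> 0}. d e * (\<Prod>i\<in>I. x i ^ e i))"
    using assms(2) unfolding mpoly_fun_def by blast
  let ?S = "{e. c e \<noteq> 0} \<times> {e. d e \<noteq> 0}"
  let ?p = "\<lambda>(e, e'). \<lambda>i. e i + e' i :: nat"
  have fin: "finite ?S" using c(1) d(1) by simp
  show ?thesis
  proof (rule mpoly_funI[of "?p ` ?S" _ _ "\<lambda>f. \<Sum>q\<in>{q \<in> ?S. ?p q = f}. c (fst q) * d (snd q)"])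
    fix x :: "'a \<Rightarrow> complex"
    have "F x * G x = (\<Sum>q\<in>?S. (c (fst q) * (\<Prod>i\<in>I. x i ^ fst q i)) * (d (snd q) * (\<Prod>i\<in>I. x i ^ snd q i)))"
      unfolding c(3) d(3) by (simp add: sum_product sum.cartesian_product case_prod_beta)
    also have "\<dots> = (\<Sum>q\<in>?S. c (fst q) * d (snd q) * (\<Prod>i\<in>I. x i ^ ?p q i))"
      by (intro sum.cong) (auto simp: power_add prod.distrib mult_ac)
    \<comment> \<open>Pairs of exponent vectors are collected by their sum.\<close>
    also have "\<dots> = (\<Sum>f\<in>?p ` ?S. \<Sum>q\<in>{q \<in> ?S. ?p q = f}. c (fst q) * d (snd q) * (\<Prod>i\<in>I. x i ^ ?p q i))"
      by (rule sum.image_gen[OF fin])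
    also have "\<dots> = (\<Sum>f\<in>?p ` ?S. (\<Sum>q\<in>{q \<in> ?S. ?p q = f}. c (fst q) * d (snd q)) * (\<Prod>i\<in>I. x i ^ f i))"
      unfolding sum_distrib_right by (intro sum.cong refl) auto
    finally show "F x * G x = \<dots>" .
  qed (use fin c(2) d(2) in auto)
qed

lemma mpoly_fun_diff:
  assumes "mpoly_fun I F" "mpoly_fun I G"
  shows "mpoly_fun I (\<lambda>x. F x - G x)"
  using mpoly_fun_add[OF assms(1) mpoly_fun_mult[OF mpoly_fun_const[of I "- 1"] assms(2)]] by simp

lemma mpoly_fun_power: "mpoly_fun I F \<Longrightarrow> mpoly_fun I (\<lambda>x. F x ^ n)"
  by (induction n) (auto intro: mpoly_fun_const mpoly_fun_mult)

text \<open>A nonzero value at one point forces a nonzero coefficient, so nontriviality is checked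
  by evaluation.\<close>

lemma alg_dependent_onI:
  assumes "mpoly_fun I F" "F x \<noteq> 0" "\<And>t. t \<in> S \<Longrightarrow> F (\<lambda>i. f i t) = 0"
  shows "alg_dependent_on S f I"
proof -
  obtain c where c: "finite {e. c e \<noteq> 0}" "\<forall>e. c e \<noteq> 0 \<longrightarrow> (\<forall>i. i \<notin> I \<longrightarrow> e i = 0)"
    "\<And>x. F x = (\<Sum>e\<in>{e. c e \<noteq> 0}. c e * (\<Prod>i\<in>I. x i ^ e i))"
    using assms(1) unfolding mpoly_fun_def by blast
  have "{e. c e \<noteq> 0} \<noteq> {}"
    using assms(2) unfolding c(3) by (metis sum.empty)
  with c(1,2) assms(3) show ?thesis
    unfolding alg_dependent_on_def c(3) by blast
qed

text \<open>Rescaling the variables by the nonzero constants \<open>r k\<close> turns the relation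
  among values of \<open>theta_unif\<close> into one among theta constants.\<close>

lemma theta_consts_alg_dependent:
  fixes k1 k2 k3 k4 :: nat
  assumes "finite K" "k1 \<in> K" "k2 \<in> K" "k3 \<in> K" "k4 \<in> K" "distinct [k1, k2, k3, k4]"
    and theta: "\<And>t. theta_unif (x + 2/5) t = theta_unif (real k1 / 5) t"
      "\<And>t. theta_unif (x + 4/5) t = theta_unif (real k2 / 5) t"
      "\<And>t. theta_unif (x + 6/5) t = theta_unif (real k3 / 5) t"
      "\<And>t. theta_unif (x + 8/5) t = theta_unif (real k4 / 5) t"
  shows "alg_dependent_on upper_half_plane (\<lambda>k tau. theta_const (1/5) (real k / 5) tau) K"
proof -
  define r where "r k = exp (- (of_real (pi * (real k / 5) / 10) * \<i>))" for k
  let ?F = "\<lambda>z. elim_poly (r k1 * z k1) (r k2 * z k2) (r k3 * z k3) (r k4 * z k4)"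
  show ?thesis
  proof (rule alg_dependent_onI)
    show "mpoly_fun K ?F"
      unfolding elim_poly_def
      by (intro mpoly_fun_diff mpoly_fun_mult mpoly_fun_power mpoly_fun_const mpoly_fun_var assms(1-5))
    \<comment> \<open>At h1 = h2 = h3 = 1, h4 = 0 one has N = 1 and D = -1, so
      \<open>elim_poly\<close> equals 2.\<close>
    show "?F (\<lambda>k. if k = k4 then 0 else inverse (r k)) \<noteq> 0"
      using assms(6) by (simp add: r_def elim_poly_def)
    fix t assume "t \<in> upper_half_plane"
    from elim_poly_theta_unif[OF this, of x]
    show "?F (\<lambda>k. theta_const (1/5) (real k / 5) t) = 0"
      unfolding theta by (simp add: theta_unif_def r_def)
  qed
qed

theorem theorem7p1:
  shows "\<forall>K \<subseteq> {1, 3, 5, 7, 9 :: nat}.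
           alg_independent_on upper_half_plane
             (\<lambda>k tau. theta_const (1/5) (real k / 5) tau) K
           \<longrightarrow> card K \<le> 3"
proof (intro allI impI)
  fix K :: "nat set"
  let ?A = "{1, 3, 5, 7, 9 :: nat}"
  assume K: "K \<subseteq> ?A"
    and indep: "alg_independent_on upper_half_plane (\<lambda>k tau. theta_const (1/5) (real k / 5) tau) K"
  have fin: "finite K" using K finite_subset by blast
  have wrap: "theta_unif (11/5) t = theta_unif (1/5) t" "theta_unif (13/5) t = theta_unif (3/5) t"
    "theta_unif 3 t = theta_unif 1 t" "theta_unif (17/5) t = theta_unif (7/5) t" for t
    using theta_unif_add_2[of "1/5" t] theta_unif_add_2[of "3/5" t]
      theta_unif_add_2[of 1 t] theta_unif_add_2[of "7/5" t] by simp_all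
  show "card K \<le> 3"
  proof (rule ccontr)
    assume "\<not> card K \<le> 3"
    then have "card (?A - K) \<le> 1"
      using K fin by (subst card_Diff_subset) auto
    moreover have "finite (?A - K)" by simp
    ultimately have le: "\<forall>k\<in>?A - K. \<forall>l\<in>?A - K. k = l"
      unfolding One_nat_def by (simp only: card_le_Suc0_iff_eq)
    \<comment> \<open>At most one index is missing from K; \<open>k\<close> is that one, or
      arbitrary if K is all of \<open>?A\<close>.\<close>
    have "\<exists>k\<in>?A. \<forall>m\<in>?A. m \<noteq> k \<longrightarrow> m \<in> K"
    proof (cases "?A - K = {}")
      case False
      then obtain k where "k \<in> ?A - K" by blast
      with le show ?thesis by blast
    qed blast
    then obtain k where k: "k \<in> ?A" "\<forall>m\<in>?A. m \<noteq> k \<longrightarrow> m \<in> K" ..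
    from k(1) consider "k = 1" | "k = 3" | "k = 5" | "k = 7" | "k = 9" by blast
    \<comment> \<open>Starting at x = k/5, steps of 2/5 run through the other four indices
      cyclically; \<open>wrap\<close> brings arguments beyond 9/5 back.\<close>
    then have "alg_dependent_on upper_half_plane (\<lambda>k tau. theta_const (1/5) (real k / 5) tau) K"
    proof cases
      case 1
      with k(2) have "3 \<in> K \<and> 5 \<in> K \<and> 7 \<in> K \<and> 9 \<in> K"
        by simp
      with fin show ?thesis
        by (intro theta_consts_alg_dependent[of K 3 5 7 9 "1/5"]) simp_all
    next
      case 2
      with k(2) have "5 \<in> K \<and> 7 \<in> K \<and> 9 \<in> K \<and> 1 \<in> K"
        by simp
      with fin show ?thesis
        by (intro theta_consts_alg_dependent[of K 5 7 9 1 "3/5"]) (simp_all add: wrap)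
    next
      case 3
      with k(2) have "7 \<in> K \<and> 9 \<in> K \<and> 1 \<in> K \<and> 3 \<in> K"
        by simp
      with fin show ?thesis
        by (intro theta_consts_alg_dependent[of K 7 9 1 3 1]) (simp_all add: wrap)
    next
      case 4
      with k(2) have "9 \<in> K \<and> 1 \<in> K \<and> 3 \<in> K \<and> 5 \<in> K"
        by simp
      with fin show ?thesis
        by (intro theta_consts_alg_dependent[of K 9 1 3 5 "7/5"]) (simp_all add: wrap)
    next
      case 5
      with k(2) have "1 \<in> K \<and> 3 \<in> K \<and> 5 \<in> K \<and> 7 \<in> K"
        by simp
      with fin show ?thesis
        by (intro theta_consts_alg_dependent[of K 1 3 5 7 "9/5"]) (simp_all add: wrap)
    qed
    with indep show False
      by (simp add: alg_independent_on_def)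
  qed
qed

end
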